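(* Let $r\in\mathbb{N}$, $\mathbf{w}\in\mathcal{S}_r$, and $\varepsilon\ge0$. Let $\mathbf{f}$ be an optimal solution of Problem (P) below, and suppose $\mathbf{f}$ has $J$ positive-sloped linear pieces, breakpoints $0<b_1<\dots<b_J$, and slopes $m_1>m_2>\dots>m_J>m_{J+1}=0$ (where $m_i$ is the slope on $[b_{i-1},b_i]$ with $b_0=0$). Let $a_i=m_i-m_{i+1}$ for $i\in[J]$ and define $\hat{\mathbf{w}}(i)=\sum_{j=1}^J a_j\min\{i,b_j\}$. Then $\hat{\mathbf{w}}$ is an optimal solution of the Sparse Gadget Approximation Problem: $\hat{\mathbf{w}}\in\mathcal{C}_r^{J}$, $\mathbf{w}(i)\le\hat{\mathbf{w}}(i)\le(1+\varepsilon)\mathbf{w}(i)$ for all $i\in[r]$, and no $\kappa<J$ admits a function $\mathbf{w}'\in\mathcal{C}_r^{\kappa}$ with $\mathbf{w}\le\mathbf{w}'\le(1+\varepsilon)\mathbf{w}$ on $[r]$.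
   Context: $[r]=\{1,\dots,r\}$. $\mathcal{S}_r$ is the set of functions $\mathbf{w}:\{0\}\cup[r]\to\mathbb{R}_{\ge0}$ with $\mathbf{w}(0)=0$, $2\mathbf{w}(j)\ge\mathbf{w}(j-1)+\mathbf{w}(j+1)$ for $j=1,\dots,r-1$, and $0\le\mathbf{w}(1)\le\dots\le\mathbf{w}(r)$. $\mathcal{C}_r^J$ is the set of $r$-CCB functions of order $J$: functions of the form $\hat{\mathbf{w}}(i)=\sum_{j=1}^J a_j\min\{i,b_j\}$ for $i\in[r]$ with $a_j>0$, $b_j>0$, $b_j<b_{j+1}$, $b_J\le r$. $\mathcal{F}_r$ is the class of functions $\mathbf{f}:[0,\infty)\to\mathbb{R}_{\ge0}$ that satisfy $\mathbf{f}(0)=0$, are constant for $x\ge r$, nondecreasing, piecewise linear (finitely many pieces), and concave. $\mathcal{L}=\{g(x)=mx+d: m,d\ge0\}$. Problem (P): minimize $|L|$ over finite $L\subset\mathcal{L}$ such that $\mathbf{f}(x)=\min_{g\in L}g(x)$ lies in $\mathcal{F}_r$, $\mathbf{w}(i)\le\mathbf{f}(i)\le(1+\varepsilon)\mathbf{w}(i)$ for all $i\in[r]$, and each $g\in L$ satisfies $g(j)=\mathbf{w}(j)$ for some $j\in\{0\}\cup[r]$; an optimal solution is identified with the function $\mathbf{f}$. *)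

theory Defs
  imports "HOL-Analysis.Analysis"
begin

text \<open>
  A function on \<open>{0} \<union> [r]\<close> (or on \<open>[r]\<close>) is represented by a function of type
  \<^typ>\<open>nat \<Rightarrow> real\<close>, and a function on \<open>[0, \<infinity>)\<close> by one of type \<^typ>\<open>real \<Rightarrow> real\<close>; all
  conditions refer only to arguments in the intended domain.
\<close>

definition splitting_functions :: "nat \<Rightarrow> (nat \<Rightarrow> real) set" where
  "splitting_functions r =
    {w \<in> {0..r} \<rightarrow> {0..}.
      w 0 = 0 \<and>
      (\<forall>j\<in>{1..<r}. 2 * w j \<ge> w (j - 1) + w (j + 1)) \<and>
      (\<forall>j\<in>{1..<r}. w j \<le> w (j + 1))}"

text \<open>
  Order \<open>J = 0\<close> is allowed: the combination is then empty, so the function vanishes on \<open>[r]\<close>.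
\<close>

definition CCB :: "nat \<Rightarrow> nat \<Rightarrow> (nat \<Rightarrow> real) set" where
  "CCB r J =
    {w. \<exists>a b :: nat \<Rightarrow> real.
      (\<forall>j\<in>{1..J}. a j > 0 \<and> b j > 0) \<and>
      (\<forall>j\<in>{1..<J}. b j < b (j + 1)) \<and>
      (J \<ge> 1 \<longrightarrow> b J \<le> real r) \<and>
      (\<forall>i\<in>{1..r}. w i = (\<Sum>j=1..J. a j * min (real i) (b j)))}"

text \<open>
  \<open>linear_pieces f n b m\<close>: on \<open>[0, \<infinity>)\<close>, the function \<open>f\<close> has slope \<open>m i\<close> on
  \<open>[b (i - 1), b i]\<close> for \<open>i = 1, \<dots>, n\<close>, where \<open>b 0 = 0\<close>, and slope \<open>m (n + 1)\<close> on
  \<open>[b n, \<infinity>)\<close>. The pieces are closed intervals, so \<open>f\<close> is continuous. Consecutive slopes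
  may coincide here.
\<close>

definition linear_pieces ::
    "(real \<Rightarrow> real) \<Rightarrow> nat \<Rightarrow> (nat \<Rightarrow> real) \<Rightarrow> (nat \<Rightarrow> real) \<Rightarrow> bool" where
  "linear_pieces f n b m \<longleftrightarrow>
    b 0 = 0 \<and>
    (\<forall>i\<in>{1..n}. b (i - 1) < b i) \<and>
    (\<forall>i\<in>{1..n}. \<forall>x\<in>{b (i - 1)..b i}. f x = f (b (i - 1)) + m i * (x - b (i - 1))) \<and>
    (\<forall>x\<ge>b n. f x = f (b n) + m (n + 1) * (x - b n))"

definition piecewise_linear :: "(real \<Rightarrow> real) \<Rightarrow> bool" where
  "piecewise_linear f \<longleftrightarrow> (\<exists>n b m. linear_pieces f n b m)"

definition pl_functions :: "nat \<Rightarrow> (real \<Rightarrow> real) set" where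
  "pl_functions r =
    {f \<in> {0..} \<rightarrow> {0..}.
      f 0 = 0 \<and>
      (\<forall>x\<ge>real r. f x = f (real r)) \<and>
      mono_on {0..} f \<and>
      piecewise_linear f \<and>
      concave_on {0..} f}"

definition nonneg_lines :: "(real \<Rightarrow> real) set" where
  "nonneg_lines = {g. \<exists>m\<ge>0. \<exists>d\<ge>0. g = (\<lambda>x. m * x + d)}"

definition approximates :: "nat \<Rightarrow> (nat \<Rightarrow> real) \<Rightarrow> real \<Rightarrow> (nat \<Rightarrow> real) \<Rightarrow> bool" where
  "approximates r w \<epsilon> v \<longleftrightarrow> (\<forall>i\<in>{1..r}. w i \<le> v i \<and> v i \<le> (1 + \<epsilon>) * w i)"

definition cover_feasible ::
    "nat \<Rightarrow> (nat \<Rightarrow> real) \<Rightarrow> real \<Rightarrow> (real \<Rightarrow> real) set \<Rightarrow> (real \<Rightarrow> real) \<Rightarrow> bool" where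
  "cover_feasible r w \<epsilon> L f \<longleftrightarrow>
    finite L \<and> L \<noteq> {} \<and> L \<subseteq> nonneg_lines \<and>
    (\<forall>x\<ge>0. f x = Min ((\<lambda>g. g x) ` L)) \<and>
    f \<in> pl_functions r \<and>
    approximates r w \<epsilon> (\<lambda>i. f (real i)) \<and>
    (\<forall>g\<in>L. \<exists>j\<in>{0..r}. g (real j) = w j)"

definition cover_optimal ::
    "nat \<Rightarrow> (nat \<Rightarrow> real) \<Rightarrow> real \<Rightarrow> (real \<Rightarrow> real) \<Rightarrow> bool" where
  "cover_optimal r w \<epsilon> f \<longleftrightarrow>
    (\<exists>L. cover_feasible r w \<epsilon> L f \<and>
      (\<forall>L' f'. cover_feasible r w \<epsilon> L' f' \<longrightarrow> card L \<le> card L'))"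

end

theory Submission
  imports Defs
begin

text \<open>
  A combination with \<open>\<kappa>\<close> terms is the lower envelope of \<open>\<kappa> + 1\<close> lines, the first through the
  origin and the last horizontal. Shifting every line down until it touches \<open>w\<close> preserves both
  inequalities and yields a feasible cover with at most \<open>\<kappa> + 1\<close> lines. Conversely, each of the
  \<open>J + 1\<close> distinct slopes of a lower envelope \<open>f\<close> is the slope of one of its lines. So an optimal
  cover, which has at least \<open>J + 1\<close> lines, excludes \<open>\<kappa> < J\<close>.
\<close>

section \<open>Lower envelopes of lines\<close>

lemma nonneg_linesE:
  assumes "g \<in> nonneg_lines"
  obtains m d where "m \<ge> 0" "d \<ge> 0" "g = (\<lambda>x. m * x + d)"
  using assms by (auto simp: nonneg_lines_def)

text \<open>The slope is read off as \<open>g 1 - g 0\<close>, so the slopes occurring in a set of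
  lines can be counted without choosing a representation of each line.\<close>

lemma nonneg_lines_slope:
  assumes "g \<in> nonneg_lines"
  shows "g y = g x + (g 1 - g 0) * (y - x)"
  using assms by (auto simp: nonneg_lines_def algebra_simps)

text \<open>Two different common points would force equal slopes and hence equal lines, so there is
  at most one crossing.\<close>

lemma finite_line_crossings:
  assumes "g \<in> nonneg_lines" "h \<in> nonneg_lines" "g \<noteq> h"
  shows "finite {x. g x = h x}"
proof (cases "\<exists>x. g x = h x")
  case True
  then obtain x where x: "g x = h x" by blast
  have "y = x" if y: "g y = h y" for y
  proof (rule ccontr)
    assume "y \<noteq> x"
    have "(g 1 - g 0) * (y - x) = (h 1 - h 0) * (y - x)"
      using nonneg_lines_slope[OF assms(1), of y x] nonneg_lines_slope[OF assms(2), of y x] x y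
      by linarith
    then have "g 1 - g 0 = h 1 - h 0" using \<open>y \<noteq> x\<close> by simp
    then have "g z = h z" for z
      using nonneg_lines_slope[OF assms(1), of z x] nonneg_lines_slope[OF assms(2), of z x] x
      by simp
    then show False using assms(3) by blast
  qed
  then have "{x. g x = h x} \<subseteq> {x}" by blast
  then show ?thesis using finite_subset by blast
qed auto

text \<open>If \<open>h\<close> dropped below \<open>g\<close> at \<open>x\<close>, the intermediate
  value theorem would give a crossing strictly between \<open>t\<close> and \<open>x\<close>. It is
  interior even if \<open>x\<close> is an endpoint, so the conclusion covers the closed
  interval.\<close>

lemma line_le_between_crossings:
  fixes u v t x :: real
  assumes "g \<in> nonneg_lines" "h \<in> nonneg_lines"
    and no_cross: "\<And>z. u < z \<Longrightarrow> z < v \<Longrightarrow> g z = h z \<Longrightarrow> g = h"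
    and t: "u < t" "t < v" "g t \<le> h t" and x: "u \<le> x" "x \<le> v"
  shows "g x \<le> h x"
proof (rule ccontr)
  assume neg: "\<not> g x \<le> h x"
  then have ne: "g \<noteq> h" by auto
  then have t': "g t < h t" using no_cross[of t] t by fastforce
  have cont: "continuous_on A (\<lambda>y. g y - h y)" for A
    using assms(1,2) by (auto elim!: nonneg_linesE intro!: continuous_intros)
  obtain z where z: "min t x \<le> z" "z \<le> max t x" "g z - h z = 0"
  proof (cases "t \<le> x")
    case True
    then show thesis
      using IVT'[of "\<lambda>y. g y - h y" t 0 x] cont t' neg that by auto
  next
    case False
    then show thesis
      using IVT2'[of "\<lambda>y. g y - h y" t 0 x] cont t' neg that by auto
  qed
  then have "z \<noteq> t" "z \<noteq> x" using t' neg by auto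
  then show False using z no_cross[of z] ne t x by (auto simp: min_def max_def split: if_splits)
qed

lemma linear_piecesD:
  assumes "linear_pieces f n b m"
  shows "b 0 = 0"
    and "\<And>i. i \<in> {1..n} \<Longrightarrow> b (i - 1) < b i"
    and "\<And>i x. i \<in> {1..n} \<Longrightarrow> b (i - 1) \<le> x \<Longrightarrow> x \<le> b i \<Longrightarrow>
      f x = f (b (i - 1)) + m i * (x - b (i - 1))"
    and "\<And>x. b n \<le> x \<Longrightarrow> f x = f (b n) + m (n + 1) * (x - b n)"
  using assms unfolding linear_pieces_def by (blast intro: atLeastAtMost_iff[THEN iffD2])+

text \<open>The breakpoints are 0 and the elements of \<open>P\<close> in increasing order. No
  element of \<open>P\<close> lies between two neighbours, so \<open>aff\<close> applies to each
  bounded piece and \<open>aff_last\<close> to the final ray.\<close>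

lemma piecewise_linear_of_breakpoints:
  assumes fin: "finite P" and pos: "P \<subseteq> {0<..}"
    and aff: "\<And>u v. 0 \<le> u \<Longrightarrow> u < v \<Longrightarrow> {u<..<v} \<inter> P = {} \<Longrightarrow>
      \<exists>s. \<forall>x\<in>{u..v}. f x = f u + s * (x - u)"
    and aff_last: "\<And>u. 0 \<le> u \<Longrightarrow> {u<..} \<inter> P = {} \<Longrightarrow> \<exists>s. \<forall>x\<ge>u. f x = f u + s * (x - u)"
  shows "piecewise_linear f"
proof -
  define xs where "xs = sorted_list_of_set (insert 0 P)"
  define n where "n = card P"
  define b where "b = (\<lambda>i. xs ! i)"
  have "0 \<notin> P" using pos by auto
  then have len: "length xs = Suc n" using fin by (simp add: xs_def n_def)
  have set: "set xs = insert 0 P"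
    unfolding xs_def using fin by (intro set_sorted_list_of_set) simp
  have less: "b i < b j" if "i < j" "j \<le> n" for i j
    using that len sorted_wrt_nth_less[OF strict_sorted_list_of_set, of i j "insert 0 P"]
    by (simp add: b_def xs_def)
  have mem: "\<exists>i\<le>n. x = b i" if "x \<in> insert 0 P" for x
    using that set len by (metis b_def in_set_conv_nth less_Suc_eq_le)
  have nonneg: "b i \<ge> 0" if "i \<le> n" for i
  proof -
    have "b i \<in> insert 0 P" using that len set by (metis b_def less_Suc_eq_le nth_mem)
    then show ?thesis using pos by auto
  qed
  have b0: "b 0 = 0"
  proof -
    obtain i where i: "i \<le> n" "0 = b i" using mem[of 0] by auto
    then show ?thesis using nonneg[of 0] less[of 0 i] by (cases "i = 0") auto
  qed
  \<comment> \<open>A point of \<open>P\<close> in the gap would be some \<open>b k\<close> with an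
    index strictly between \<open>i - 1\<close> and \<open>i\<close>.\<close>
  have gap: "{b (i - 1)<..<b i} \<inter> P = {}" if i: "i \<in> {1..n}" for i
  proof (rule ccontr)
    assume "\<not> ?thesis"
    then obtain k where k: "k \<le> n" "b (i - 1) < b k" "b k < b i"
      using mem by (metis disjoint_iff greaterThanLessThan_iff insertI2)
    have "i - 1 \<le> n" using i by auto
    then have "i - 1 < k" using k less[of k "i - 1"] by (cases k "i - 1" rule: linorder_cases) auto
    moreover have "k < i" using k less[of i k] by (cases k i rule: linorder_cases) auto
    ultimately show False by simp
  qed
  have gap_last: "{b n<..} \<inter> P = {}"
  proof (rule ccontr)
    assume "\<not> ?thesis"
    then obtain k where "k \<le> n" "b n < b k"
      using mem by (metis disjoint_iff greaterThan_iff insertI2)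
    then show False using less[of k n] by (cases "k = n") auto
  qed
  have "\<forall>i\<in>{1..n}. \<exists>s. \<forall>x\<in>{b (i - 1)..b i}. f x = f (b (i - 1)) + s * (x - b (i - 1))"
    using aff gap less nonneg by auto
  then obtain s where s: "\<forall>i\<in>{1..n}. \<forall>x\<in>{b (i - 1)..b i}.
      f x = f (b (i - 1)) + s i * (x - b (i - 1))"
    by metis
  obtain s' where s': "\<forall>x\<ge>b n. f x = f (b n) + s' * (x - b n)"
    using aff_last[of "b n"] gap_last nonneg by auto
  \<comment> \<open>\<open>linear_pieces\<close> expects the slope of the unbounded piece at index
    \<open>n + 1\<close>, just beyond the indices for which \<open>s\<close> was chosen.\<close>
  have "linear_pieces f n b (s(Suc n := s'))"
    unfolding linear_pieces_def
  proof (intro conjI ballI)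
    fix i x assume i: "i \<in> {1..n}" and "x \<in> {b (i - 1)..b i}"
    then have "f x = f (b (i - 1)) + s i * (x - b (i - 1))" using s by blast
    then show "f x = f (b (i - 1)) + (s(Suc n := s')) i * (x - b (i - 1))" using i by auto
  next
    fix i assume "i \<in> {1..n}"
    then show "b (i - 1) < b i" using less by auto
  next
    show "\<forall>x\<ge>b n. f x = f (b n) + (s(Suc n := s')) (n + 1) * (x - b n)"
      unfolding Suc_eq_plus1 fun_upd_same by (rule s')
  qed (rule b0)
  then show ?thesis unfolding piecewise_linear_def by blast
qed

section \<open>Regularity and slopes of a lower envelope\<close>

context
  fixes L :: "(real \<Rightarrow> real) set" and f :: "real \<Rightarrow> real"
  assumes finite_L: "finite L" and L_ne: "L \<noteq> {}" and lines: "L \<subseteq> nonneg_lines"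
    and envelope: "\<And>x. x \<ge> 0 \<Longrightarrow> f x = Min ((\<lambda>g. g x) ` L)"
begin

lemma envelope_le: "g \<in> L \<Longrightarrow> x \<ge> 0 \<Longrightarrow> f x \<le> g x"
  using finite_L by (simp add: envelope)

lemma envelope_attained:
  assumes "x \<ge> 0"
  obtains g where "g \<in> L" "f x = g x"
proof -
  have "Min ((\<lambda>g. g x) ` L) \<in> (\<lambda>g. g x) ` L" using finite_L L_ne by (intro Min_in) auto
  then show ?thesis using that envelope[OF assms] by (metis imageE)
qed

lemma envelope_nonneg:
  assumes "x \<ge> 0"
  shows "f x \<ge> 0"
proof -
  obtain g where "g \<in> L" "f x = g x" using envelope_attained[OF assms] .
  moreover from this have "g \<in> nonneg_lines" using lines by blast
  ultimately show ?thesis using assms by (auto elim!: nonneg_linesE)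
qed

text \<open>The line attaining \<open>f\<close> at the larger argument is nondecreasing and lies
  above \<open>f\<close> at the smaller one.\<close>

lemma envelope_mono: "mono_on {0..} f"
proof (rule mono_onI)
  fix x y :: real assume "x \<in> {0..}" "y \<in> {0..}" and le: "x \<le> y"
  then have xy: "x \<ge> 0" "y \<ge> 0" by auto
  obtain g where g: "g \<in> L" "f y = g y" using envelope_attained[OF xy(2)] .
  have "f x \<le> g x" using envelope_le g xy by blast
  also have "g x \<le> g y"
    using subsetD[OF lines g(1)] le by (auto elim!: nonneg_linesE intro!: mult_left_mono)
  finally show "f x \<le> f y" using g by simp
qed

text \<open>The line attaining \<open>f\<close> at the convex combination lies above
  \<open>f\<close> at both endpoints, and a line commutes with convex combinations.\<close>

lemma envelope_concave: "concave_on {0..} f"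
  unfolding concave_on_iff
proof (intro conjI ballI allI impI)
  fix x y u v :: real
  assume xy: "x \<in> {0..}" "y \<in> {0..}" and uv: "0 \<le> u" "0 \<le> v" "u + v = 1"
  have "u *\<^sub>R x + v *\<^sub>R y \<ge> 0" using xy uv by auto
  then obtain g where g: "g \<in> L" "f (u *\<^sub>R x + v *\<^sub>R y) = g (u *\<^sub>R x + v *\<^sub>R y)"
    using envelope_attained by blast
  then obtain s d where gd: "g = (\<lambda>x. s * x + d)"
    using nonneg_linesE subsetD[OF lines] by metis
  have "u * f x + v * f y \<le> u * g x + v * g y"
    using envelope_le[OF g(1)] xy uv by (auto intro!: add_mono mult_left_mono)
  also have "\<dots> = s * (u * x + v * y) + (u + v) * d"
    by (simp add: gd algebra_simps)
  also have "\<dots> = f (u *\<^sub>R x + v *\<^sub>R y)"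
    unfolding g(2) uv(3) by (simp add: gd)
  finally show "u * f x + v * f y \<le> f (u *\<^sub>R x + v *\<^sub>R y)" .
qed simp

text \<open>The candidate breakpoints are the positive crossings of distinct lines of
  \<open>L\<close>. Between them the order of the lines cannot change, so one line stays
  minimal.\<close>

lemma envelope_piecewise_linear: "piecewise_linear f"
proof -
  define P where "P = {x. 0 < x \<and> (\<exists>g\<in>L. \<exists>h\<in>L. g \<noteq> h \<and> g x = h x)}"
  have "P \<subseteq> (\<Union>g\<in>L. \<Union>h\<in>L - {g}. {x. g x = h x})"
    by (auto simp: P_def)
  moreover have "finite (\<Union>g\<in>L. \<Union>h\<in>L - {g}. {x. g x = h x})"
    using finite_L lines by (intro finite_UN_I finite_line_crossings) auto
  ultimately have fin: "finite P" by (rule finite_subset)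
  \<comment> \<open>Whichever line \<open>h\<close> attains \<open>f\<close> at \<open>x\<close> is
    not below \<open>g\<close> at \<open>t\<close>; without a crossing it is not below
    \<open>g\<close> at \<open>x\<close> either.\<close>
  have single: "f x = g x"
    if uv: "0 \<le> u" "{u<..<v} \<inter> P = {}" and t: "u < t" "t < v" and g: "g \<in> L" "f t = g t"
      and x: "u \<le> x" "x \<le> v" for u v t x g
  proof (rule antisym)
    show "f x \<le> g x" using envelope_le g uv x by auto
    obtain h where h: "h \<in> L" "f x = h x" using envelope_attained[of x] uv x by auto
    have "g = h" if "u < z" "z < v" "g z = h z" for z
      using that uv g(1) h(1) by (auto simp: P_def disjoint_iff)
    moreover have "g t \<le> h t" using envelope_le[OF h(1), of t] g(2) uv t by simp
    ultimately have "g x \<le> h x"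
      using line_le_between_crossings[of g h u v t x] lines g(1) h(1) t x by blast
    then show "g x \<le> f x" using h by simp
  qed
  show ?thesis
  proof (rule piecewise_linear_of_breakpoints[OF fin])
    show "P \<subseteq> {0<..}" by (auto simp: P_def)
  next
    fix u v :: real assume uv: "0 \<le> u" "u < v" "{u<..<v} \<inter> P = {}"
    have mid: "u < (u + v) / 2" "(u + v) / 2 < v" using uv by auto
    obtain g where g: "g \<in> L" "f ((u + v) / 2) = g ((u + v) / 2)"
      using envelope_attained[of "(u + v) / 2"] uv by auto
    have "f x = f u + (g 1 - g 0) * (x - u)" if "x \<in> {u..v}" for x
      using single[OF uv(1,3) mid g] that uv nonneg_lines_slope[of g x u] lines g(1) by auto
    then show "\<exists>s. \<forall>x\<in>{u..v}. f x = f u + s * (x - u)" by blast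
  next
    fix u :: real assume u: "0 \<le> u" "{u<..} \<inter> P = {}"
    obtain g where g: "g \<in> L" "f (u + 1) = g (u + 1)"
      using envelope_attained[of "u + 1"] u by auto
    have eq: "f x = g x" if "x \<ge> u" for x
    proof (rule single[OF u(1) _ _ _ g])
      \<comment> \<open>\<open>single\<close> speaks of a bounded interval, so the ray is cut off
        beyond both \<open>x\<close> and the sample point \<open>u + 1\<close>.\<close>
      show "{u<..<max x (u + 1) + 1} \<inter> P = {}" using u by auto
    qed (use that in auto)
    have "f x = f u + (g 1 - g 0) * (x - u)" if "x \<ge> u" for x
      using eq that nonneg_lines_slope[of g x u] lines g(1) by auto
    then show "\<exists>s. \<forall>x\<ge>u. f x = f u + s * (x - u)" by blast
  qed
qed

text \<open>A line of \<open>L\<close> attaining \<open>f\<close> at an interior point of a piece lies above \<open>f\<close> on both sides.\<close>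
lemma slope_of_envelope_piece:
  assumes "0 \<le> u" "u < v" and aff: "\<And>x. u \<le> x \<Longrightarrow> x \<le> v \<Longrightarrow> f x = f u + s * (x - u)"
  shows "s \<in> (\<lambda>g. g 1 - g 0) ` L"
proof -
  define t where "t = (u + v) / 2"
  have t: "u < t" "t < v" "t \<ge> 0" using assms(1,2) by (auto simp: t_def)
  obtain g where g: "g \<in> L" "f t = g t" using envelope_attained[OF t(3)] .
  define D where "D = g 1 - g 0"
  have line: "g y = g t + D * (y - t)" for y
    unfolding D_def using nonneg_lines_slope lines g(1) by blast
  have above: "f u \<le> g u" "f v \<le> g v" using envelope_le[OF g(1)] assms(1,2) by auto
  have "f t = f u + s * (t - u)" "f v = f u + s * (v - u)"
    using t by (intro aff; simp)+
  \<comment> \<open>The left endpoint bounds \<open>s\<close> from below by \<open>D\<close>, the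
    right endpoint bounds it from above.\<close>
  then have "s * (t - u) \<ge> D * (t - u)" "s * (v - t) \<le> D * (v - t)"
    using above line[of u] line[of v] g(2) by (auto simp: algebra_simps)
  then have "s = D" using t by (simp add: mult_le_cancel_right)
  then show ?thesis using g(1) D_def by blast
qed

text \<open>Strictly decreasing slopes are distinct, and each is the slope of some line of
  \<open>L\<close>, so the slope map takes at least \<open>n + 1\<close> values on
  \<open>L\<close>.\<close>

lemma card_envelope_ge:
  assumes pieces: "linear_pieces f n b m" and decr: "\<forall>i\<in>{1..n}. m i > m (i + 1)"
  shows "n + 1 \<le> card L"
proof -
  note b0 = linear_piecesD(1)[OF pieces] and less = linear_piecesD(2)[OF pieces]
  have nonneg: "b i \<ge> 0" if "i \<le> n" for i
    using that
  proof (induction i)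
    case (Suc i)
    then show ?case using less[of "Suc i"] by simp
  qed (simp add: b0)
  have "m i \<in> (\<lambda>g. g 1 - g 0) ` L" if i: "i \<in> {1..n + 1}" for i
  proof (cases "i = n + 1")
    case True
    show ?thesis
    proof (rule slope_of_envelope_piece)
      \<comment> \<open>Any bounded subinterval of the ray shows its slope; length 1 is an arbitrary
        choice.\<close>
      show "0 \<le> b n" "b n < b n + 1" using nonneg by auto
      show "f x = f (b n) + m i * (x - b n)" if "b n \<le> x" for x
        unfolding True using linear_piecesD(4)[OF pieces that] .
    qed
  next
    case False
    then have i: "i \<in> {1..n}" using i by auto
    show ?thesis
      by (rule slope_of_envelope_piece[OF _ less[OF i] linear_piecesD(3)[OF pieces i]])
        (use nonneg i in auto)
  qed
  then have sub: "m ` {1..n + 1} \<subseteq> (\<lambda>g. g 1 - g 0) ` L" by auto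
  have anti: "m j < m i" if "i \<ge> 1" "i < j" "j \<le> n + 1" for i j
    using that(2,3)
  proof (induction j)
    case (Suc j)
    then have "m (j + 1) < m j" using decr that(1) by auto
    then show ?case using Suc by (cases "i = j") auto
  qed simp
  have "inj_on m {1..n + 1}"
  proof (rule linorder_inj_onI')
    fix i j assume "i \<in> {1..n + 1}" "j \<in> {1..n + 1}" "i < j"
    then show "m i \<noteq> m j" using anti[of i j] by auto
  qed
  then have "n + 1 = card (m ` {1..n + 1})" by (simp add: card_image)
  also have "\<dots> \<le> card ((\<lambda>g. g 1 - g 0) ` L)" using sub finite_L by (intro card_mono) auto
  also have "\<dots> \<le> card L" using finite_L by (rule card_image_le)
  finally show ?thesis .
qed

end

section \<open>Combinations of capped functions\<close>

lemma le_of_increasing_steps: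
  fixes b :: "nat \<Rightarrow> real"
  assumes "\<forall>j\<in>{1..<J}. b j < b (j + 1)" "1 \<le> i" "i \<le> j" "j \<le> J"
  shows "b i \<le> b j"
  using assms(3,4)
proof (induction j rule: dec_induct)
  case (step j)
  then have "b j < b (j + 1)" using assms(1,2) by auto
  then show ?case using step by simp
qed simp

text \<open>Up to index \<open>k\<close> the caps are reached and contribute constants; beyond
  \<open>k\<close> they are not and contribute slope. As \<open>k\<close> runs from 0 to
  \<open>J\<close>, the right-hand sides are the lines from which the sum is assembled.\<close>

lemma capped_sum_eq:
  fixes x :: real and k J :: nat
  assumes "k \<le> J" "\<And>j. 1 \<le> j \<Longrightarrow> j \<le> k \<Longrightarrow> b j \<le> x" "\<And>j. k < j \<Longrightarrow> j \<le> J \<Longrightarrow> x \<le> b j"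
  shows "(\<Sum>j=1..J. a j * min x (b j)) = (\<Sum>j=k+1..J. a j) * x + (\<Sum>j=1..k. a j * b j)"
proof -
  have "(\<Sum>j=1..J. a j * min x (b j)) =
      (\<Sum>j=1..k. a j * min x (b j)) + (\<Sum>j=k+1..J. a j * min x (b j))"
    using assms(1) sum.ub_add_nat[of 1 k _ "J - k"] by simp
  also have "(\<Sum>j=1..k. a j * min x (b j)) = (\<Sum>j=1..k. a j * b j)"
    using assms(2) by (intro sum.cong) (auto simp: min_absorb2)
  also have "(\<Sum>j=k+1..J. a j * min x (b j)) = (\<Sum>j=k+1..J. a j * x)"
    using assms(3) by (intro sum.cong) auto
  finally show ?thesis by (simp add: sum_distrib_right)
qed

text \<open>Each minimum is bounded by its cap up to \<open>k\<close> and by \<open>x\<close>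
  afterwards, so every line of the family lies above the sum.\<close>

lemma capped_sum_le:
  fixes x :: real and k J :: nat
  assumes "k \<le> J" "\<And>j. j \<in> {1..J} \<Longrightarrow> a j \<ge> 0"
  shows "(\<Sum>j=1..J. a j * min x (b j)) \<le> (\<Sum>j=k+1..J. a j) * x + (\<Sum>j=1..k. a j * b j)"
proof -
  have "(\<Sum>j=1..J. a j * min x (b j)) =
      (\<Sum>j=1..k. a j * min x (b j)) + (\<Sum>j=k+1..J. a j * min x (b j))"
    using assms(1) sum.ub_add_nat[of 1 k _ "J - k"] by simp
  also have "\<dots> \<le> (\<Sum>j=1..k. a j * b j) + (\<Sum>j=k+1..J. a j * x)"
    using assms by (intro add_mono sum_mono mult_left_mono) auto
  finally show ?thesis by (simp add: sum_distrib_right)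
qed

text \<open>Both sides vanish at 0 and have the same slope on every piece: the weights beyond index
  \<open>k\<close> telescope to \<open>m (k + 1)\<close> because the last slope is 0.\<close>

lemma linear_pieces_capped_sum:
  assumes pieces: "linear_pieces f J b m" and last: "m (J + 1) = 0" and f0: "f 0 = 0"
    and x: "x \<ge> 0"
  shows "f x = (\<Sum>j=1..J. (m j - m (j + 1)) * min x (b j))"
proof -
  define F where "F = (\<lambda>x. \<Sum>j=1..J. (m j - m (j + 1)) * min x (b j))"
  note b0 = linear_piecesD(1)[OF pieces] and less = linear_piecesD(2)[OF pieces]
  have chain: "b i \<le> b j" if "i \<le> j" "j \<le> J" for i j
    using that
  proof (induction j rule: dec_induct)
    case (step j)
    then show ?case using less[of "Suc j"] by auto
  qed simp
  \<comment> \<open>The upper bound on \<open>y\<close> is conditional, so that \<open>k = J\<close>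
    covers the unbounded piece.\<close>
  have F_piece: "F y = F (b k) + m (k + 1) * (y - b k)"
    if k: "k \<le> J" "b k \<le> y" "k < J \<Longrightarrow> y \<le> b (k + 1)" for k y
  proof -
    have tel: "(\<Sum>j=k+1..J. m j - m (j + 1)) = m (k + 1)"
      using sum_Suc_diff[of "k + 1" J "\<lambda>j. - m j"] k(1) last by (auto simp: algebra_simps)
    have "F z = m (k + 1) * z + (\<Sum>j=1..k. (m j - m (j + 1)) * b j)"
      if z: "b k \<le> z" "k < J \<Longrightarrow> z \<le> b (k + 1)" for z
      unfolding F_def tel[symmetric]
    proof (rule capped_sum_eq[OF k(1)])
      show "b j \<le> z" if "1 \<le> j" "j \<le> k" for j
        using chain[of j k] that k z by linarith
      show "z \<le> b j" if "k < j" "j \<le> J" for j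
        using chain[of "k + 1" j] that z by force
    qed
    from this[of y] this[of "b k"] show ?thesis
      using k chain[of k "k + 1"] by (simp add: algebra_simps)
  qed
  have F0: "F 0 = 0"
    unfolding F_def using chain[of 0] b0 by (intro sum.neutral) auto
  \<comment> \<open>Equality at one breakpoint extends over the next piece, where both functions
    continue with the same slope.\<close>
  have upto: "f y = F y" if "k \<le> J" "0 \<le> y" "y \<le> b k" for k y
    using that
  proof (induction k arbitrary: y)
    case 0
    then show ?case using b0 f0 F0 by auto
  next
    case (Suc k)
    show ?case
    proof (cases "y \<le> b k")
      case False
      have "f y = f (b k) + m (Suc k) * (y - b k)"
        using linear_piecesD(3)[OF pieces, of "Suc k" y] Suc.prems False by simp
      moreover have "f (b k) = F (b k)"
        using Suc chain[of 0 k] b0 by auto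
      ultimately show ?thesis using F_piece[of k y] Suc.prems False by simp
    qed (use Suc in auto)
  qed
  show ?thesis
  proof (cases "x \<le> b J")
    case True
    then show ?thesis using upto[of J x] x by (simp add: F_def)
  next
    case False
    then have "f x = f (b J) + m (J + 1) * (x - b J)"
      using linear_piecesD(4)[OF pieces, of x] by simp
    moreover have "f (b J) = F (b J)" using upto[of J "b J"] chain[of 0 J] b0 by auto
    ultimately show ?thesis using F_piece[of J x] False by (simp add: F_def)
  qed
qed

section \<open>From a combination to a feasible cover\<close>

lemma splitting_functions_le_last:
  assumes w: "w \<in> splitting_functions r" and "j \<le> r"
  shows "w j \<le> w r"
proof (cases "j = 0")
  case True
  then show ?thesis using w by (auto simp: splitting_functions_def Pi_def)
next
  case False
  from assms(2) show ?thesis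
  proof (induction j rule: inc_induct)
    case (step n)
    \<comment> \<open>\<open>splitting_functions\<close> gives monotone steps only from 1 on; the
      argument 0 is settled by \<open>w 0 = 0\<close> and nonnegativity.\<close>
    then have "w n \<le> w (Suc n)" if "n \<ge> 1"
      using w that by (auto simp: splitting_functions_def)
    moreover have "w 0 \<le> w r" using w by (auto simp: splitting_functions_def Pi_def)
    ultimately show ?case using step by (cases "n = 0") auto
  qed simp
qed

lemma cover_of_CCB:
  assumes w: "w \<in> splitting_functions r"
    and w': "w' \<in> CCB r \<kappa>" "approximates r w \<epsilon> w'"
  obtains L f where "cover_feasible r w \<epsilon> L f" "card L \<le> \<kappa> + 1"
proof -
  obtain a b where pos: "\<And>j. j \<in> {1..\<kappa>} \<Longrightarrow> a j > 0 \<and> b j > 0"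
    and incr: "\<forall>j\<in>{1..<\<kappa>}. b j < b (j + 1)"
    and w'_eq: "\<And>i. i \<in> {1..r} \<Longrightarrow> w' i = (\<Sum>j=1..\<kappa>. a j * min (real i) (b j))"
    using w'(1) unfolding CCB_def by blast
  have w0: "w 0 = 0" using w by (simp add: splitting_functions_def)
  \<comment> \<open>Line \<open>k\<close> has slope \<open>s k\<close> and intercept
    \<open>d k\<close>, as if exactly the first \<open>k\<close> caps were reached. Its smallest gap
    \<open>c k\<close> to \<open>w\<close> on \<open>{0..r}\<close> is the shift that makes it touch
    \<open>w\<close>.\<close>
  define s where "s = (\<lambda>k. \<Sum>j=k+1..\<kappa>. a j)"
  define d where "d = (\<lambda>k. \<Sum>j=1..k. a j * b j)"
  define c where "c = (\<lambda>k. Min ((\<lambda>j. s k * real j + d k - w j) ` {0..r}))"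
  define g where "g = (\<lambda>k x. s k * x + (d k - c k))"
  define L where "L = g ` {0..\<kappa>}"
  define f where "f = (\<lambda>x. Min ((\<lambda>h. h x) ` L))"
  have s_nonneg: "s k \<ge> 0" for k
    unfolding s_def using pos by (intro sum_nonneg) (auto simp: less_imp_le)
  \<comment> \<open>The argument 0 is treated separately because \<open>approximates\<close>
    compares \<open>w\<close> and \<open>w'\<close> only from 1 to \<open>r\<close>.\<close>
  have above: "s k * real j + d k \<ge> w j" if k: "k \<le> \<kappa>" and j: "j \<le> r" for k j
  proof (cases "j = 0")
    case True
    have "d k \<ge> 0" unfolding d_def using pos k by (intro sum_nonneg) (auto simp: less_imp_le)
    then show ?thesis using True w0 by simp
  next
    case False
    then have "w j \<le> w' j" using w'(2) j by (auto simp: approximates_def)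
    also have "w' j \<le> s k * real j + d k"
      using w'_eq[of j] False j capped_sum_le[OF k, of a "real j" b] pos
      by (auto simp: s_def d_def less_imp_le)
    finally show ?thesis .
  qed
  have c_le: "c k \<le> s k * real j + d k - w j" if "j \<le> r" for k j
    unfolding c_def using that by (intro Min_le) auto
  have c_touch: "\<exists>j\<in>{0..r}. c k = s k * real j + d k - w j" for k
  proof -
    have "c k \<in> (\<lambda>j. s k * real j + d k - w j) ` {0..r}"
      unfolding c_def by (intro Min_in) auto
    then show ?thesis by blast
  qed
  have c_nonneg: "c k \<ge> 0" if "k \<le> \<kappa>" for k
    using c_touch[of k] above[OF that] by force
  have g_line: "g k \<in> nonneg_lines" for k
  proof -
    have "s k \<ge> 0" "d k - c k \<ge> 0" using s_nonneg c_le[of 0 k] w0 by auto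
    then show ?thesis unfolding nonneg_lines_def g_def by blast
  qed
  have fin: "finite L" and ne: "L \<noteq> {}" and lines: "L \<subseteq> nonneg_lines"
    using g_line by (auto simp: L_def)
  have env: "f x = Min ((\<lambda>h. h x) ` L)" for x by (simp add: f_def)
  note le = envelope_le[OF fin ne lines env]
    and attained = envelope_attained[OF fin ne lines env]
    and nonneg = envelope_nonneg[OF fin ne lines env]
  have g_above: "w j \<le> g k (real j)" if "j \<le> r" for k j
    using c_le[OF that, of k] by (simp add: g_def)
  have f_above: "w j \<le> f (real j)" if "j \<le> r" for j
  proof -
    obtain h where "h \<in> L" "f (real j) = h (real j)" using attained[of "real j"] by auto
    then show ?thesis using g_above[OF that] by (auto simp: L_def)
  qed
  have f0: "f 0 = 0"
  proof -
    have "f 0 \<le> g 0 0" using le by (simp add: L_def)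
    also have "g 0 0 \<le> 0" using c_nonneg[of 0] by (simp add: g_def d_def)
    finally show ?thesis using nonneg[of 0] by simp
  qed
  \<comment> \<open>Line \<kappa> is horizontal and touches \<open>w\<close>, so its height is at
    most the largest value \<open>w r\<close>; from below, \<open>f\<close> is at least
    \<open>w r\<close> at \<open>r\<close> and monotone.\<close>
  have const: "f x = w r" if x: "x \<ge> real r" for x
  proof (rule antisym)
    have "f x \<le> g \<kappa> x" using le x by (simp add: L_def)
    also have "g \<kappa> x \<le> w r"
      using c_touch[of \<kappa>] splitting_functions_le_last[OF w] by (auto simp: g_def s_def)
    finally show "f x \<le> w r" .
    have "w r \<le> f (real r)" using f_above by simp
    also have "\<dots> \<le> f x"
      using mono_onD[OF envelope_mono[OF fin ne lines env]] x by simp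
    finally show "w r \<le> f x" .
  qed
  have f_below: "f (real i) \<le> w' i" if i: "i \<in> {1..r}" for i
  proof -
    \<comment> \<open>\<open>k\<close> is the last index whose cap is at most \<open>i\<close>;
      inserting 0 handles the case that there is none. Line \<open>k\<close> before its downward
      shift agrees with \<open>w'\<close> at \<open>i\<close>.\<close>
    define k where "k = Max (insert 0 {j \<in> {1..\<kappa>}. b j \<le> real i})"
    have k_in: "k \<in> insert 0 {j \<in> {1..\<kappa>}. b j \<le> real i}"
      unfolding k_def by (intro Max_in) auto
    have k_max: "j \<le> k" if "j \<in> {1..\<kappa>}" "b j \<le> real i" for j
      unfolding k_def using that by (intro Max_ge) auto
    have k: "k \<le> \<kappa>" using k_in by auto
    have "w' i = s k * real i + d k"
      unfolding s_def d_def w'_eq[OF i]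
    proof (rule capped_sum_eq[OF k])
      show "b j \<le> real i" if "1 \<le> j" "j \<le> k" for j
        using le_of_increasing_steps[OF incr that k] k_in that by auto
      show "real i \<le> b j" if "k < j" "j \<le> \<kappa>" for j
        using k_max[of j] that by force
    qed
    moreover have "f (real i) \<le> g k (real i)" using le k by (simp add: L_def)
    ultimately show ?thesis using c_nonneg[OF k] by (simp add: g_def)
  qed
  have "approximates r w \<epsilon> (\<lambda>i. f (real i))"
    using f_above f_below w'(2) by (force simp: approximates_def)
  moreover have "f \<in> pl_functions r"
    using nonneg f0 const envelope_mono[OF fin ne lines env]
      envelope_concave[OF fin ne lines env] envelope_piecewise_linear[OF fin ne lines env]
    by (simp add: pl_functions_def)
  moreover have "\<forall>h\<in>L. \<exists>j\<in>{0..r}. h (real j) = w j"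
  proof
    fix h assume "h \<in> L"
    then obtain k where k: "h = g k" by (auto simp: L_def)
    obtain j where "j \<in> {0..r}" "c k = s k * real j + d k - w j" using c_touch by blast
    then show "\<exists>j\<in>{0..r}. h (real j) = w j" by (intro bexI[of _ j]) (auto simp: k g_def)
  qed
  ultimately have "cover_feasible r w \<epsilon> L f"
    using fin ne lines by (simp add: cover_feasible_def f_def)
  moreover have "card L \<le> \<kappa> + 1"
    unfolding L_def using card_image_le[of "{0..\<kappa>}" g] by simp
  ultimately show ?thesis using that by blast
qed

section \<open>Optimality of the combination read off from an optimal envelope\<close>

theorem theorem7:
  fixes r J :: nat
    and w what :: "nat \<Rightarrow> real"
    and \<epsilon> :: real
    and f :: "real \<Rightarrow> real"
    and a b m :: "nat \<Rightarrow> real"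
  assumes "w \<in> splitting_functions r"
    and "\<epsilon> \<ge> 0"
    and "cover_optimal r w \<epsilon> f"
    and "linear_pieces f J b m"
    and "\<forall>i\<in>{1..J}. m i > m (i + 1)"
    and "m (J + 1) = 0"
    and "\<forall>i\<in>{1..J}. a i = m i - m (i + 1)"
    and "\<forall>i\<in>{1..r}. what i = (\<Sum>j=1..J. a j * min (real i) (b j))"
  shows "what \<in> CCB r J \<and> approximates r w \<epsilon> what \<and>
    \<not> (\<exists>\<kappa><J. \<exists>w'\<in>CCB r \<kappa>. approximates r w \<epsilon> w')"
proof (intro conjI)
  obtain L where feas: "cover_feasible r w \<epsilon> L f"
    and opt: "\<And>L' f'. cover_feasible r w \<epsilon> L' f' \<Longrightarrow> card L \<le> card L'"
    using assms(3) unfolding cover_optimal_def by blast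
  have f: "f \<in> pl_functions r" and approx: "approximates r w \<epsilon> (\<lambda>i. f (real i))"
    using feas by (auto simp: cover_feasible_def)
  have f0: "f 0 = 0" and const: "\<And>x. x \<ge> real r \<Longrightarrow> f x = f (real r)"
    using f unfolding pl_functions_def by blast+
  \<comment> \<open>At integer arguments the combination is \<open>f\<close> itself, so the
    approximation bounds carry over.\<close>
  have what: "what i = f (real i)" if "i \<in> {1..r}" for i
    using assms(7,8) that linear_pieces_capped_sum[OF assms(4,6) f0, of "real i"] by simp
  show "approximates r w \<epsilon> what"
    using approx what by (simp add: approximates_def)
  note b0 = linear_piecesD(1)[OF assms(4)] and less = linear_piecesD(2)[OF assms(4)]
  have pos: "b i > 0" if "i \<ge> 1" "i \<le> J" for i
    using that
  proof (induction i rule: dec_induct)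
    case base
    then show ?case using less[of 1] b0 by simp
  next
    case (step n)
    then show ?case using less[of "Suc n"] by auto
  qed
  \<comment> \<open>Otherwise the last sloped piece would extend beyond \<open>r\<close>, where
    \<open>f\<close> is constant, forcing \<open>m J = 0\<close> although the slopes decrease
    strictly to 0. The point \<open>x\<close> below is the first one of that piece not left of
    \<open>r\<close>.\<close>
  have "b J \<le> real r" if "J \<ge> 1"
  proof (rule ccontr)
    assume gt: "\<not> b J \<le> real r"
    define x where "x = max (real r) (b (J - 1))"
    have x: "b (J - 1) \<le> x" "x < b J" "real r \<le> x"
      using gt less[of J] that by (auto simp: x_def)
    from linear_piecesD(3)[OF assms(4), of J x] linear_piecesD(3)[OF assms(4), of J "b J"]
    have "m J * (b J - x) = f (b J) - f x"
      using x that by (simp add: algebra_simps)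
    also have "\<dots> = 0" using const[of x] const[of "b J"] x by linarith
    finally have "m J = 0" using x by simp
    then show False using assms(5,6) that by force
  qed
  moreover have "b j < b (j + 1)" if "j \<in> {1..<J}" for j
    using less[of "j + 1"] that by auto
  ultimately show "what \<in> CCB r J"
    unfolding CCB_def using assms(5,7,8) pos
    by (intro CollectI exI[of _ a] exI[of _ b]) auto
  \<comment> \<open>Both bounds on \<open>card L\<close> carry the same \<open>+ 1\<close>, so
    comparing them gives J \<le> \<kappa>.\<close>
  have "J + 1 \<le> card L"
    using feas card_envelope_ge[OF _ _ _ _ assms(4,5), of L] by (simp add: cover_feasible_def)
  moreover have "card L \<le> \<kappa> + 1" if w': "w' \<in> CCB r \<kappa>" "approximates r w \<epsilon> w'" for \<kappa> w'
  proof -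
    obtain L' f' where "cover_feasible r w \<epsilon> L' f'" "card L' \<le> \<kappa> + 1"
      using cover_of_CCB[OF assms(1) w'] .
    then show ?thesis using opt by force
  qed
  ultimately show "\<not> (\<exists>\<kappa><J. \<exists>w'\<in>CCB r \<kappa>. approximates r w \<epsilon> w')"
    by fastforce
qed

end
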